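(* Let $\mathbb{F}_q$ be a finite field of odd characteristic with $q>5$ elements and let $GRS_k(\mathbb{F}_q,\mathbb{F}_q)$ be the extended Reed-Solomon code (evaluation set $D=\mathbb{F}_q$). For all integers $k$ with $2\le k\le q-3$, all $u\in\mathbb{F}_q^*$, all $a,b\in\mathbb{F}_q$ and all polynomials $h(x)\in\mathbb{F}_q[x]$ of degree at most $k-1$, the polynomial $f(x)=ux^{k+2}+ax^{k+1}+bx^k+h(x)$ does not define a deep hole of $GRS_k(\mathbb{F}_q,\mathbb{F}_q)$.
   Context: Enumerate $\mathbb{F}_q=\{x_1,\dots,x_n\}$ with $n=q$. The extended Reed-Solomon code is $GRS_k(\mathbb{F}_q,\mathbb{F}_q)=\{(g(x_1),\dots,g(x_n))\in\mathbb{F}_q^n : g\in\mathbb{F}_q[x],\ \deg g\le k-1\}$ (the zero polynomial is allowed). For $f\in\mathbb{F}_q[x]$, the word defined by $f$ is $u_f=(f(x_1),\dots,f(x_n))$. The Hamming distance is $d(v,w)=\#\{i: v_i\ne w_i\}$ and the error distance is $d(v,C)=\min\{d(v,w): w\in C\}$. The polynomial $f$ is said to define a deep hole of $C=GRS_k(\mathbb{F}_q,\mathbb{F}_q)$ if $d(u_f,C)=n-k=q-k$. *)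

theory Defs
  imports "HOL-Computational_Algebra.Computational_Algebra" "HOL-Library.Cardinality"
begin

text \<open>
  Words of length \<open>n\<close> are lists, and an evaluation set \<open>{x\<^sub>1, \<dots>, x\<^sub>n}\<close> with a chosen enumeration
  is a distinct list \<open>xs\<close>.
\<close>

definition eval_word :: "'a::comm_semiring_0 list \<Rightarrow> 'a poly \<Rightarrow> 'a list" where
  "eval_word xs f = map (poly f) xs"

text \<open>
  The library sets \<open>degree 0 = 0\<close>, so the zero polynomial is listed separately; the condition
  then also says \<open>deg g \<le> k - 1\<close> correctly for \<open>k = 0\<close>.
\<close>

definition GRS :: "nat \<Rightarrow> 'a::comm_semiring_0 list \<Rightarrow> 'a list set" where
  "GRS k xs = {eval_word xs g | g. g = 0 \<or> degree g < k}"

text \<open>Only meant for words of equal length.\<close>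

definition hamming_dist :: "'a list \<Rightarrow> 'a list \<Rightarrow> nat" where
  "hamming_dist v w = card {i. i < length v \<and> v ! i \<noteq> w ! i}"

text \<open>
  The distances from \<open>v\<close> are bounded by \<open>length v\<close>, so the minimum is over a finite set; it is
  meaningful for nonempty \<open>C\<close>.
\<close>

definition error_dist :: "'a list \<Rightarrow> 'a list set \<Rightarrow> nat" where
  "error_dist v C = Min {hamming_dist v w | w. w \<in> C}"

text \<open>Intended for \<open>k \<le> length xs\<close>, where the subtraction does not truncate.\<close>

definition defines_deep_hole :: "nat \<Rightarrow> 'a::comm_semiring_0 list \<Rightarrow> 'a poly \<Rightarrow> bool" where
  "defines_deep_hole k xs f \<longleftrightarrow> error_dist (eval_word xs f) (GRS k xs) = length xs - k"

end

theory Submission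
  imports Defs
begin

text \<open>
  The polynomial \<open>f = u x\<^sup>k\<^sup>+\<^sup>2 + a x\<^sup>k\<^sup>+\<^sup>1 + b x\<^sup>k + h\<close> agrees on a set \<open>S\<close> of \<open>k + 1\<close> points
  with a polynomial of degree less than \<open>k\<close> as soon as its divided difference over \<open>S\<close> vanishes.
  In odd characteristic this reads \<open>(p\<^sub>1 + \<alpha>)\<^sup>2 + p\<^sub>2 = c\<close> with \<open>\<alpha> = a / u\<close>, \<open>c = \<alpha>\<^sup>2 - 2 b / u\<close> and
  \<open>p\<^sub>i\<close> the power sums of \<open>S\<close>; such an \<open>S\<close> rules out a deep hole. Let \<open>m = k + 1\<close>, read in the field.
  If \<open>m = 0\<close>, or \<open>m = -1\<close> and \<open>\<alpha> \<noteq> 0\<close>, the left-hand side is affine and nonconstant along the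
  translates of a suitable \<open>S\<close>. If \<open>m \<noteq> 0, -1\<close>, some translate of \<open>S\<close> works iff
  \<open>C - (m + 1) (m p\<^sub>2 - p\<^sub>1\<^sup>2)\<close> is a square, \<open>C\<close> being a constant; this is arranged by
  scaling \<open>S\<close> when \<open>C \<noteq> 0\<close> and by varying one point of \<open>S\<close> (or of its complement) when \<open>C = 0\<close>.
  If \<open>m = -1\<close> and \<open>\<alpha> = 0\<close>, take a union of additive cosets of the prime field, with two points
  \<open>r, s\<close> replaced by \<open>0\<close>: this contributes \<open>2 r s\<close>, which can be prescribed.
\<close>

section \<open>Squares and values of quadratic polynomials in a finite field\<close>

definition is_sq :: "'a::semiring_1 \<Rightarrow> bool" where
  "is_sq x \<longleftrightarrow> (\<exists>z. x = z\<^sup>2)"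

lemma is_sq_mult: "is_sq x \<Longrightarrow> is_sq y \<Longrightarrow> is_sq (x * y :: 'a::comm_semiring_1)"
  unfolding is_sq_def by (metis power_mult_distrib)

lemma is_sq_power2 [simp]: "is_sq (z\<^sup>2)"
  unfolding is_sq_def by blast

lemma is_sq_0 [simp]: "is_sq (0::'a::semiring_1)"
  unfolding is_sq_def by (metis zero_power2)

lemma is_sq_mult_cancel:
  fixes x z :: "'a::field"
  assumes "is_sq (z\<^sup>2 * x)" "z \<noteq> 0"
  shows "is_sq x"
proof -
  obtain y where "z\<^sup>2 * x = y\<^sup>2" using assms(1) unfolding is_sq_def by blast
  then have "x = (y / z)\<^sup>2" using assms(2) by (simp add: field_simps power_divide)
  then show ?thesis by simp
qed

lemma card_Compl_finite: "card (- S) = CARD('a) - card (S :: 'a::finite set)"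
  by (simp add: Compl_eq_Diff_UNIV card_Diff_subset)

lemma card_eq_sum_card_fibres:
  assumes "finite A"
  shows "card A = (\<Sum>y\<in>f ` A. card {x \<in> A. f x = y})"
  using sum.image_gen[OF assms, of "\<lambda>_. 1::nat" f] by simp

lemma card_le_twice_card_image:
  assumes "finite A" "\<And>y. card {x \<in> A. f x = y} \<le> 2"
  shows "card A \<le> 2 * card (f ` A)"
  unfolding card_eq_sum_card_fibres[OF assms(1), of f]
  using sum_bounded_above[of "f ` A" "\<lambda>y. card {x \<in> A. f x = y}" 2] assms(2) by simp

lemma twice_card_image_le_card:
  assumes "finite A" "\<And>y. y \<in> f ` A \<Longrightarrow> 2 \<le> card {x \<in> A. f x = y}"
  shows "2 * card (f ` A) \<le> card A"
  unfolding card_eq_sum_card_fibres[OF assms(1), of f]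
  using sum_bounded_below[of "f ` A" 2 "\<lambda>y. card {x \<in> A. f x = y}"] assms(2) by simp

lemma card_quadratic_roots_le:
  fixes A B G :: "'a::field"
  assumes "A \<noteq> 0 \<or> B \<noteq> 0 \<or> G \<noteq> 0"
  shows "finite {t. A * t\<^sup>2 + B * t + G = 0} \<and> card {t. A * t\<^sup>2 + B * t + G = 0} \<le> 2"
proof -
  let ?p = "[:G, B, A:]"
  have eq: "{t. A * t\<^sup>2 + B * t + G = 0} = {t. poly ?p t = 0}"
    by (auto simp: algebra_simps power2_eq_square)
  have "?p \<noteq> 0" using assms by auto
  moreover have "degree ?p \<le> 2" by (auto simp: degree_pCons_eq_if)
  ultimately show ?thesis
    unfolding eq using card_poly_roots_bound[of ?p] poly_roots_finite[of ?p] by linarith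
qed

text \<open>Squaring is exactly two-to-one on the nonzero elements, since \<open>z\<close> and
  \<open>- z\<close> differ when 2 is nonzero.\<close>

lemma twice_card_nonzero_squares:
  assumes two: "(2::'a::{finite,field}) \<noteq> 0"
  shows "2 * card {x::'a. x \<noteq> 0 \<and> is_sq x} = CARD('a) - 1"
proof -
  let ?A = "- {0::'a}" and ?f = "\<lambda>z::'a. z\<^sup>2"
  have im: "?f ` ?A = {x. x \<noteq> 0 \<and> is_sq x}" by (auto simp: is_sq_def)
  have fibre: "card {x \<in> ?A. ?f x = y} = 2" if y: "y \<in> ?f ` ?A" for y
  proof -
    obtain z where z: "y = z\<^sup>2" "z \<noteq> 0" using y by blast
    have "z \<noteq> - z" using z(2) two by (metis add_cancel_right_right add_neg_numeral_special(9)
      eq_neg_iff_add_eq_0 mult_2 mult_eq_0_iff)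
    moreover have "{x \<in> ?A. ?f x = y} = {z, - z}" using z by (auto simp: power2_eq_iff)
    ultimately show ?thesis by simp
  qed
  have "card ?A = (\<Sum>y\<in>?f ` ?A. card {x \<in> ?A. ?f x = y})"
    by (rule card_eq_sum_card_fibres) simp
  also have "\<dots> = 2 * card (?f ` ?A)" using fibre by simp
  finally show ?thesis unfolding im by (simp add: card_Compl_finite)
qed

lemma odd_CARD_field:
  assumes two: "(2::'a::{finite,field}) \<noteq> 0"
  shows "odd CARD('a)"
proof -
  have "CARD('a) \<ge> 1" by (simp add: Suc_leI)
  then have "CARD('a) = Suc (2 * card {x::'a. x \<noteq> 0 \<and> is_sq x})"
    using twice_card_nonzero_squares[OF two] by simp
  then show ?thesis by (metis even_Suc dvd_triv_left)
qed

text \<open>By counting, the nonzero squares and their multiples by the nonsquare \<open>A\<close>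
  partition the nonzero elements. Hence \<open>x = A * r\<^sup>2\<close> for some
  \<open>r\<close>.\<close>

lemma is_sq_mult_nonsquares:
  fixes A x :: "'a::{finite,field}"
  assumes two: "(2::'a) \<noteq> 0" and A: "\<not> is_sq A" and x: "\<not> is_sq x"
  shows "is_sq (A * x)"
proof -
  let ?R = "{x::'a. x \<noteq> 0 \<and> is_sq x}"
  have A0: "A \<noteq> 0" "x \<noteq> 0" using A x by auto
  have disj: "?R \<inter> (*) A ` ?R = {}"
  proof (rule ccontr)
    assume "?R \<inter> (*) A ` ?R \<noteq> {}"
    then obtain r s where rs: "r \<noteq> 0" "A * r\<^sup>2 = s\<^sup>2" by (auto simp: is_sq_def)
    then have "is_sq A" using is_sq_mult_cancel[of r A] by (simp add: mult.commute)
    then show False using A by simp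
  qed
  have "card (?R \<union> (*) A ` ?R) = card ?R + card ((*) A ` ?R)"
    using disj by (intro card_Un_disjoint) auto
  also have "card ((*) A ` ?R) = card ?R"
    using A0 by (intro card_image) (auto simp: inj_on_def)
  also have "card ?R + card ?R = card (- {0::'a})"
    using twice_card_nonzero_squares[OF two] by (simp add: card_Compl_finite)
  finally have "?R \<union> (*) A ` ?R = - {0}"
    using A0 by (intro card_subset_eq) auto
  then obtain r where "x = A * r\<^sup>2" using x A0 by (auto simp: is_sq_def)
  then have "A * x = (A * r)\<^sup>2" by (simp add: power2_eq_square)
  then show ?thesis by simp
qed

text \<open>The substitution \<open>v = (r + D / r) / 2\<close> parametrises the \<open>v\<close> for which \<open>v\<^sup>2 - D\<close> is a square.\<close>
lemma card_square_values_centred: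
  fixes A D :: "'a::{finite,field}"
  assumes two: "(2::'a) \<noteq> 0" and A: "A \<noteq> 0" and D: "D \<noteq> 0"
  shows "CARD('a) - 1 \<le> 2 * card {v. is_sq (A * (v\<^sup>2 - D))}"
proof -
  define f where "f r = (r + D / r) / 2" for r :: 'a
  have four: "(4::'a) \<noteq> 0"
    using two by (metis mult_2 mult_eq_0_iff numeral_Bit0)
  have f_iff: "f r = v \<longleftrightarrow> r\<^sup>2 - 2 * v * r + D = 0" if "r \<noteq> 0" for r v
    using that two by (auto simp: f_def field_simps power2_eq_square)
  show ?thesis
  proof (cases "is_sq A")
    case True
    have "is_sq (A * ((f r)\<^sup>2 - D))" if "r \<noteq> 0" for r
    proof -
      have "(f r)\<^sup>2 - D = ((r - D / r) / 2)\<^sup>2"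
        using that two four by (simp add: f_def field_simps power2_eq_square)
      then show ?thesis using True is_sq_mult is_sq_power2 by metis
    qed
    then have "f ` (- {0}) \<subseteq> {v. is_sq (A * (v\<^sup>2 - D))}" by auto
    then have le: "card (f ` (- {0})) \<le> card {v. is_sq (A * (v\<^sup>2 - D))}"
      by (intro card_mono) auto
    have "card {r \<in> - {0}. f r = v} \<le> 2" for v
    proof -
      have "{r \<in> - {0}. f r = v} \<subseteq> {r. 1 * r\<^sup>2 + (- 2 * v) * r + D = 0}"
        using f_iff by auto
      then show ?thesis
        using card_quadratic_roots_le[of 1 "- 2 * v" D] card_mono
        by (metis (no_types, lifting) le_trans zero_neq_one)
    qed
    then have "card (- {0::'a}) \<le> 2 * card (f ` (- {0}))"
      by (intro card_le_twice_card_image) auto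
    then show ?thesis using le by (simp add: card_Compl_finite)
  next
    case False
    \<comment> \<open>For nonsquare \<open>A\<close> every \<open>v\<close> outside \<open>B\<close>
      counts, as \<open>v\<^sup>2 - D\<close> is then zero or a nonsquare. \<open>B\<close> is small
      because each of its members has two preimages \<open>v + w\<close> and \<open>v - w\<close>
      under \<open>f\<close>.\<close>
    define B where "B = {v. \<exists>w. w \<noteq> 0 \<and> v\<^sup>2 - D = w\<^sup>2}"
    define E where "E = {r. r \<noteq> 0 \<and> f r \<in> B}"
    have fibre: "\<exists>r s. r \<noteq> s \<and> {r, s} \<subseteq> {r \<in> E. f r = v}" if v: "v \<in> B" for v
    proof -
      obtain w where w: "w \<noteq> 0" "v\<^sup>2 - D = w\<^sup>2" using v by (auto simp: B_def)
      have Deq: "(v + w) * (v - w) = D" using w(2) by (simp add: algebra_simps power2_eq_square)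
      then have nz: "v + w \<noteq> 0" "v - w \<noteq> 0" using D by auto
      have "(v + w)\<^sup>2 - 2 * v * (v + w) + (v + w) * (v - w) = 0"
        "(v - w)\<^sup>2 - 2 * v * (v - w) + (v + w) * (v - w) = 0"
        by (simp_all add: algebra_simps power2_eq_square)
      then have "f (v + w) = v" "f (v - w) = v"
        using f_iff nz Deq by metis+
      then have "{v + w, v - w} \<subseteq> {r \<in> E. f r = v}" using nz v by (simp add: E_def)
      moreover have "v + w \<noteq> v - w"
      proof
        assume "v + w = v - w"
        moreover have "2 * w = (v + w) - (v - w)" by simp
        ultimately have "2 * w = 0" by (metis diff_self)
        then show False using two w(1) by simp
      qed
      ultimately show ?thesis by blast
    qed
    have "2 \<le> card {r \<in> E. f r = v}" if "v \<in> f ` E" for v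
    proof -
      have "v \<in> B" using that by (auto simp: E_def)
      then obtain r s where rs: "r \<noteq> s" "{r, s} \<subseteq> {r \<in> E. f r = v}" using fibre by blast
      then have "card {r, s} \<le> card {r \<in> E. f r = v}" by (intro card_mono) auto
      then show ?thesis using rs(1) by simp
    qed
    then have "2 * card (f ` E) \<le> card E" by (intro twice_card_image_le_card) auto
    moreover have "f ` E = B" using fibre by (fastforce simp: E_def)
    moreover have "card E \<le> card (- {0::'a})" by (intro card_mono) (auto simp: E_def)
    ultimately have B: "2 * card B \<le> CARD('a) - 1" by (simp add: card_Compl_finite)
    have "- B \<subseteq> {v. is_sq (A * (v\<^sup>2 - D))}"
    proof
      fix v assume "v \<in> - B"
      then have "v\<^sup>2 - D = 0 \<or> \<not> is_sq (v\<^sup>2 - D)"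
        unfolding B_def is_sq_def by (metis (mono_tags, lifting) Compl_iff mem_Collect_eq zero_power2)
      then have "is_sq (A * (v\<^sup>2 - D))" using is_sq_mult_nonsquares[OF two False] by auto
      then show "v \<in> {v. is_sq (A * (v\<^sup>2 - D))}" by simp
    qed
    then have "card (- B) \<le> card {v. is_sq (A * (v\<^sup>2 - D))}" by (intro card_mono) auto
    moreover have "card (- B) = CARD('a) - card B" by (simp add: card_Compl_finite)
    ultimately show ?thesis using B by linarith
  qed
qed

text \<open>Completing the square reduces to the centred case with \<open>D\<close> the
  discriminant; a linear polynomial is a bijection. The bound serves to find a good \<open>t\<close>
  outside a given smaller set.\<close>

lemma card_square_values:
  fixes A B G :: "'a::{finite,field}"
  assumes two: "(2::'a) \<noteq> 0"
    and nondeg: "A \<noteq> 0 \<Longrightarrow> B\<^sup>2 - 4 * A * G \<noteq> 0" "A = 0 \<Longrightarrow> B \<noteq> 0"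
  shows "CARD('a) - 1 \<le> 2 * card {t. is_sq (A * t\<^sup>2 + B * t + G)}"
proof (cases "A = 0")
  case True
  then have B: "B \<noteq> 0" using nondeg(2) by simp
  have "card {x::'a. x \<noteq> 0 \<and> is_sq x} \<le> card {t. is_sq (A * t\<^sup>2 + B * t + G)}"
    by (rule card_inj_on_le[of "\<lambda>z. (z - G) / B"])
      (use True B in \<open>auto simp: inj_on_def\<close>)
  then show ?thesis using twice_card_nonzero_squares[OF two] by simp
next
  case False
  let ?D = "B\<^sup>2 - 4 * A * G"
  have tA: "2 * A \<noteq> 0" using False two by simp
  have sq: "is_sq (A * ((v - B) / (2 * A))\<^sup>2 + B * ((v - B) / (2 * A)) + G)"
    if v: "is_sq (A * (v\<^sup>2 - ?D))" for v
  proof -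
    define t where "t = (v - B) / (2 * A)"
    have "v = 2 * A * t + B" using tA by (simp add: t_def)
    then have "A * (v\<^sup>2 - ?D) = (2 * A)\<^sup>2 * (A * t\<^sup>2 + B * t + G)"
      by (simp add: algebra_simps power2_eq_square)
    then show ?thesis using v is_sq_mult_cancel[OF _ tA] unfolding t_def by metis
  qed
  have "card {v. is_sq (A * (v\<^sup>2 - ?D))} \<le> card {t. is_sq (A * t\<^sup>2 + B * t + G)}"
    by (rule card_inj_on_le[of "\<lambda>v. (v - B) / (2 * A)"])
      (use False two sq in \<open>auto simp: inj_on_def\<close>)
  then show ?thesis
    using card_square_values_centred[OF two False nondeg(1)[OF False]] by linarith
qed

section \<open>Power sums of subsets\<close>

definition psum :: "nat \<Rightarrow> 'a::comm_semiring_1 set \<Rightarrow> 'a" where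
  "psum i S = (\<Sum>x\<in>S. x ^ i)"

text \<open>This is the sum of \<open>(x - y)\<^sup>2\<close> over all unordered pairs in \<open>S\<close>.\<close>
definition spread :: "'a::comm_ring_1 set \<Rightarrow> 'a" where
  "spread S = of_nat (card S) * psum 2 S - (psum 1 S)\<^sup>2"

lemma psum_insert:
  "finite S \<Longrightarrow> x \<notin> S \<Longrightarrow> psum i (insert x S) = x ^ i + psum i S"
  by (simp add: psum_def)

lemma psum_remove:
  fixes S :: "'a::comm_ring_1 set"
  shows "finite S \<Longrightarrow> x \<in> S \<Longrightarrow> psum i (S - {x}) = psum i S - x ^ i"
  by (simp add: psum_def sum_diff1)

lemma psum_union:
  "finite S \<Longrightarrow> finite T \<Longrightarrow> S \<inter> T = {} \<Longrightarrow> psum i (S \<union> T) = psum i S + psum i T"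
  by (simp add: psum_def sum.union_disjoint)

lemma psum_translate:
  fixes t :: "'a::comm_ring_1"
  shows "psum 1 ((\<lambda>x. x + t) ` S) = psum 1 S + of_nat (card S) * t"
    and "psum 2 ((\<lambda>x. x + t) ` S) = psum 2 S + 2 * t * psum 1 S + of_nat (card S) * t\<^sup>2"
proof -
  have re: "psum i ((\<lambda>x. x + t) ` S) = (\<Sum>x\<in>S. (x + t) ^ i)" for i
    unfolding psum_def by (subst sum.reindex) (auto simp: inj_on_def)
  show "psum 1 ((\<lambda>x. x + t) ` S) = psum 1 S + of_nat (card S) * t"
    unfolding re by (simp add: psum_def sum.distrib)
  show "psum 2 ((\<lambda>x. x + t) ` S) = psum 2 S + 2 * t * psum 1 S + of_nat (card S) * t\<^sup>2"
    unfolding re by (simp add: psum_def power2_sum sum.distrib sum_distrib_left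
      sum_distrib_right algebra_simps)
qed

lemma card_translate: "card ((\<lambda>x. x + t) ` S) = card (S :: 'a::ab_group_add set)"
  by (simp add: card_image)

lemma psum_scale:
  fixes y :: "'a::field"
  assumes "y \<noteq> 0"
  shows "psum i ((*) y ` S) = y ^ i * psum i S"
  unfolding psum_def using assms
  by (subst sum.reindex) (auto simp: inj_on_def power_mult_distrib sum_distrib_left)

lemma spread_scale:
  fixes y :: "'a::field"
  assumes "y \<noteq> 0"
  shows "spread ((*) y ` S) = y\<^sup>2 * spread S"
proof -
  have "card ((*) y ` S) = card S" using assms by (intro card_image) (auto simp: inj_on_def)
  then show ?thesis
    unfolding spread_def psum_scale[OF assms] by (simp add: algebra_simps power2_eq_square)
qed

lemma spread_insert:
  fixes t :: "'a::comm_ring_1"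
  assumes "finite W" "t \<notin> W"
  shows "spread (insert t W) = of_nat (card W) * t\<^sup>2 - 2 * psum 1 W * t
    + (of_nat (card W + 1) * psum 2 W - (psum 1 W)\<^sup>2)"
  using assms by (simp add: spread_def psum_insert algebra_simps power2_eq_square)

text \<open>Multiplication by some \<open>g\<close> other than 0, 1, -1 permutes the field and
  multiplies the two sums by \<open>g\<close> and \<open>g\<^sup>2\<close>, both different from 1.
  Such a \<open>g\<close> exists because q > 3.\<close>

lemma psum_UNIV:
  assumes two: "(2::'a::{finite,field}) \<noteq> 0" and q: "CARD('a) > 3"
  shows "psum 1 (UNIV::'a set) = 0" "psum 2 (UNIV::'a set) = 0" "of_nat CARD('a) = (0::'a)"
proof -
  have surj: "range ((*) y) = UNIV" if "y \<noteq> 0" for y :: 'a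
    by (rule surjI[of _ "\<lambda>x. x / y"]) (use that in simp)
  have "card {0, 1, - 1 :: 'a} \<le> 3" by (simp add: card_insert_if)
  then have "{0, 1, - 1 :: 'a} \<noteq> UNIV" using q by (metis not_le)
  then obtain g :: 'a where g: "g \<noteq> 0" "g \<noteq> 1" "g \<noteq> - 1" by blast
  have "psum 1 (UNIV::'a set) = g * psum 1 UNIV" "psum 2 (UNIV::'a set) = g\<^sup>2 * psum 2 UNIV"
    using psum_scale[OF g(1), of 1 UNIV] psum_scale[OF g(1), of 2 UNIV] surj[OF g(1)] by simp_all
  moreover have "g\<^sup>2 \<noteq> 1" using g by (simp add: power2_eq_1_iff)
  ultimately show "psum 1 (UNIV::'a set) = 0" "psum 2 (UNIV::'a set) = 0" using g(2) by simp_all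
  have "range (\<lambda>x::'a. x + 1) = UNIV" by (rule surjI[of _ "\<lambda>x. x - 1"]) simp
  then show "of_nat CARD('a) = (0::'a)" using psum_translate(1)[of "1::'a" UNIV] by simp
qed

text \<open>Passing to the complement negates both power sums and the size read in the field; the
  spread is homogeneous of degree 2 in these three quantities.\<close>

lemma spread_Compl:
  fixes S :: "'a::{finite,field} set"
  assumes two: "(2::'a) \<noteq> 0" and q: "CARD('a) > 3"
  shows "spread (- S) = spread S"
proof -
  have "psum i S + psum i (- S) = psum i UNIV" for i
    using psum_union[of S "- S" i] by simp
  then have "psum 1 (- S) = - psum 1 S" "psum 2 (- S) = - psum 2 S"
    using psum_UNIV[OF two q] by (metis minus_unique)+
  moreover have "of_nat (card S) + of_nat (card (- S)) = (0::'a)"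
  proof -
    have "card S + card (- S) = CARD('a)"
      by (simp add: card_Compl_finite card_mono)
    then show ?thesis using psum_UNIV(3)[OF two q] by (metis of_nat_add)
  qed
  then have "of_nat (card (- S)) = - (of_nat (card S) :: 'a)" by (metis minus_unique)
  ultimately show ?thesis by (simp add: spread_def)
qed

section \<open>Subsets of prescribed size with nonzero or square spread\<close>

lemma exists_psum_ne_0:
  assumes "1 \<le> m" "m < CARD('a::{finite,field})"
  shows "\<exists>S::'a set. card S = m \<and> psum 1 S \<noteq> 0"
proof -
  have "m - 1 \<le> CARD('a)" using assms by simp
  then obtain W :: "'a set" where W: "card W = m - 1"
    using obtain_subset_with_card_n by metis
  then have "2 \<le> card (- W)" using assms by (simp add: card_Compl_finite)
  then obtain x y where xy: "x \<in> - W" "y \<in> - W" "x \<noteq> y"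
    by (metis card_2_iff insert_subset obtain_subset_with_card_n)
  then have "psum 1 (insert x W) \<noteq> psum 1 (insert y W)" by (simp add: psum_insert)
  moreover have "card (insert x W) = m" "card (insert y W) = m" using xy W assms by auto
  ultimately show ?thesis by metis
qed

text \<open>As a polynomial in one added point \<open>t\<close>, the spread has the nonzero linear
  coefficient \<open>- 2 * psum 1 W\<close>, hence at most two roots, while at least three points
  lie outside \<open>W\<close>.\<close>

lemma exists_spread_ne_0:
  assumes two: "(2::'a::{finite,field}) \<noteq> 0" and m: "2 \<le> m" "m \<le> CARD('a) - 2"
  shows "\<exists>S::'a set. card S = m \<and> spread S \<noteq> 0"
proof -
  obtain W :: "'a set" where W: "card W = m - 1" "psum 1 W \<noteq> 0"
    using exists_psum_ne_0[where 'a = 'a and m = "m - 1"] m by fastforce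
  let ?A = "of_nat (card W) :: 'a" and ?B = "- 2 * psum 1 W"
    and ?G = "of_nat (card W + 1) * psum 2 W - (psum 1 W)\<^sup>2"
  have "card {t. ?A * t\<^sup>2 + ?B * t + ?G = 0} \<le> 2"
    using card_quadratic_roots_le[of ?A ?B ?G] two W(2) by simp
  moreover have "card (- W) \<ge> 3" using W(1) m by (simp add: card_Compl_finite)
  ultimately have "\<not> - W \<subseteq> {t. ?A * t\<^sup>2 + ?B * t + ?G = 0}"
    using card_mono[of "{t. ?A * t\<^sup>2 + ?B * t + ?G = 0}" "- W"] by fastforce
  then obtain t where t: "t \<notin> W" "?A * t\<^sup>2 + ?B * t + ?G \<noteq> 0" by blast
  then have "spread (insert t W) \<noteq> 0" by (simp add: spread_insert)
  moreover have "card (insert t W) = m" using t(1) W(1) m by simp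
  ultimately show ?thesis by blast
qed

text \<open>As a function of the last point of \<open>S\<close> the spread is a quadratic polynomial, whose
  discriminant is a multiple of the spread of the other points.\<close>
lemma exists_square_spread_small:
  fixes d :: "'a::{finite,field}"
  assumes two: "(2::'a) \<noteq> 0" and d: "d \<noteq> 0"
    and m: "3 \<le> m" "2 * m < CARD('a)" "of_nat m \<noteq> (0::'a)"
  shows "\<exists>S. card S = m \<and> is_sq (d * spread S)"
proof -
  obtain W :: "'a set" where W: "card W = m - 1" "spread W \<noteq> 0"
    using exists_spread_ne_0[OF two, of "m - 1"] m by fastforce
  define n where "n = (of_nat (card W) :: 'a)"
  have n1: "n + 1 \<noteq> 0" using m W(1) unfolding n_def
    by (metis One_nat_def Suc_leD Suc_pred' add.commute numeral_3_eq_3 of_nat_Suc order_less_le_trans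
      zero_less_Suc)
  define A where "A = d * n"
  define B where "B = - 2 * d * psum 1 W"
  define G where "G = d * ((n + 1) * psum 2 W - (psum 1 W)\<^sup>2)"
  have sp: "spread W = n * psum 2 W - (psum 1 W)\<^sup>2" by (simp add: spread_def n_def)
  have val: "d * spread (insert t W) = A * t\<^sup>2 + B * t + G" if "t \<notin> W" for t
    using that by (simp add: spread_insert A_def B_def G_def n_def algebra_simps)
  have "B\<^sup>2 - 4 * A * G = (2 * d)\<^sup>2 * (- (n + 1) * spread W)"
    by (simp add: sp A_def B_def G_def algebra_simps power2_eq_square)
  moreover have "2 * d \<noteq> 0" "- (n + 1) * spread W \<noteq> 0"
    using two d n1 W(2) by (simp, metis mult_eq_0_iff neg_equal_0_iff_equal)
  ultimately have disc: "B\<^sup>2 - 4 * A * G \<noteq> 0" by (metis mult_eq_0_iff power_eq_0_iff)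
  have "B \<noteq> 0" if "A = 0" using that disc by auto
  then have "CARD('a) - 1 \<le> 2 * card {t. is_sq (A * t\<^sup>2 + B * t + G)}"
    using card_square_values[OF two] disc by blast
  \<comment> \<open>Since \<open>2 * m < CARD('a)\<close>, the m - 1 points of \<open>W\<close>
    cannot exhaust the at least (q - 1) / 2 good values of \<open>t\<close>.\<close>
  then have "card W < card {t. is_sq (A * t\<^sup>2 + B * t + G)}" using W(1) m by linarith
  then have "\<not> {t. is_sq (A * t\<^sup>2 + B * t + G)} \<subseteq> W" by (meson card_mono finite not_le)
  then obtain t where t: "t \<notin> W" "is_sq (A * t\<^sup>2 + B * t + G)" by blast
  then have "is_sq (d * spread (insert t W))" using val by simp
  moreover have "card (insert t W) = m" using t(1) W(1) m by simp
  ultimately show ?thesis by blast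
qed

text \<open>For m above q / 2 the complement is small enough and has the same spread; m = q / 2 is
  impossible because q is odd.\<close>

lemma exists_square_spread:
  fixes d :: "'a::{finite,field}"
  assumes two: "(2::'a) \<noteq> 0" and q: "CARD('a) > 3" and d: "d \<noteq> 0"
    and m: "3 \<le> m" "m \<le> CARD('a) - 3" "of_nat m \<noteq> (0::'a)"
  shows "\<exists>S. card S = m \<and> is_sq (d * spread S)"
proof (cases "2 * m < CARD('a)")
  case True
  then show ?thesis using exists_square_spread_small[OF two d] m by blast
next
  case False
  have "2 * m \<noteq> CARD('a)" using odd_CARD_field[OF two] by (metis dvd_triv_left)
  then have m': "2 * (CARD('a) - m) < CARD('a)" "3 \<le> CARD('a) - m" using False m by linarith+
  have "of_nat (CARD('a) - m) = - (of_nat m :: 'a)"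
    using m psum_UNIV(3)[OF two q] by (simp add: of_nat_diff)
  then obtain S :: "'a set" where S: "card S = CARD('a) - m" "is_sq (d * spread S)"
    using exists_square_spread_small[OF two d m'(2,1)] m(3) by auto
  have "card (- S) = m" using S(1) m m' by (simp add: card_Compl_finite)
  then show ?thesis using S(2) spread_Compl[OF two q] by metis
qed

text \<open>Solving for the translation \<open>t\<close> of a subset \<open>S\<close> is a quadratic equation whose
  discriminant depends on \<open>S\<close> only through its spread.\<close>
lemma exists_subset_generic:
  fixes a c :: "'a::{finite,field}"
  assumes two: "(2::'a) \<noteq> 0" and q: "CARD('a) > 3"
    and m: "3 \<le> m" "m \<le> CARD('a) - 2"
    and m0: "of_nat m \<noteq> (0::'a)" and m1: "of_nat m \<noteq> (- 1::'a)"
  shows "\<exists>S. card S = m \<and> (psum 1 S + a)\<^sup>2 + psum 2 S = c"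
proof -
  define n where "n = (of_nat m :: 'a)"
  \<comment> \<open>Multiplying the equation for the translate by \<open>n * (n + 1)\<close> and
    completing the square in \<open>t\<close> equates a square with
    \<open>C - (n + 1) * spread S\<close>.\<close>
  define C where "C = n * ((n + 1) * c - a\<^sup>2)"
  have n: "n \<noteq> 0" "n + 1 \<noteq> 0" using m0 m1 by (auto simp: n_def add_eq_0_iff2)
  have "\<exists>S. card S = m \<and> is_sq (C - (n + 1) * spread S)"
  proof (cases "C = 0")
    case False
    obtain S :: "'a set" where S: "card S = m" "spread S \<noteq> 0"
      using exists_spread_ne_0[OF two, of m] m by fastforce
    define l where "l = (n + 1) * spread S"
    have l: "l \<noteq> 0" using n S by (simp add: l_def)
    \<comment> \<open>Scaling \<open>S\<close> by \<open>y\<close> turns the quantity into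
      \<open>C - l * y\<^sup>2\<close>, with nonzero discriminant. More than one \<open>y\<close>
      makes it a square, so some nonzero \<open>y\<close> does.\<close>
    have "CARD('a) - 1 \<le> 2 * card {y. is_sq (- l * y\<^sup>2 + 0 * y + C)}"
    proof (rule card_square_values[OF two])
      have "(2::'a)\<^sup>2 * (l * C) \<noteq> 0" using two l False by (metis mult_eq_0_iff power_eq_0_iff)
      moreover have "0\<^sup>2 - 4 * - l * C = 2\<^sup>2 * (l * C)" by simp
      ultimately show "0\<^sup>2 - 4 * - l * C \<noteq> 0" by metis
    qed (use l in simp)
    then have "card {0::'a} < card {y. is_sq (- l * y\<^sup>2 + 0 * y + C)}"
      using q by simp
    then have "\<not> {y. is_sq (- l * y\<^sup>2 + 0 * y + C)} \<subseteq> {0}" by (meson card_mono finite not_le)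
    then obtain y where y: "y \<noteq> 0" "is_sq (- l * y\<^sup>2 + 0 * y + C)" by blast
    have "- l * y\<^sup>2 + 0 * y + C = C - (n + 1) * spread ((*) y ` S)"
      by (simp add: spread_scale[OF y(1)] l_def)
    moreover have "card ((*) y ` S) = m"
      using y(1) S(1) by (subst card_image) (auto simp: inj_on_def)
    ultimately show ?thesis using y(2) by metis
  next
    case True
    show ?thesis
    proof (cases "m \<le> CARD('a) - 3")
      case True
      then obtain S where S: "card S = m" "is_sq (- (n + 1) * spread S)"
        using exists_square_spread[OF two q, of "- (n + 1)" m] m m0 n by (auto simp: add_eq_0_iff)
      have "- (n + 1) * spread S = C - (n + 1) * spread S"
        using \<open>C = 0\<close> by (simp add: algebra_simps)
      then show ?thesis using S by metis
    next
      case False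
      \<comment> \<open>The complement now has only two points, too few for
        \<open>exists_square_spread\<close>. With \<open>n = - 2\<close> and \<open>C = 0\<close>
        the quantity is the spread itself, which is 1 for the complement of {0, 1}.\<close>
      then have me: "m = CARD('a) - 2" using m by simp
      have "n = - 2" using psum_UNIV(3)[OF two q] q by (simp add: n_def me of_nat_diff)
      moreover have "spread (- {0, 1::'a}) = 1"
        unfolding spread_Compl[OF two q] by (simp add: spread_def psum_def)
      ultimately have "is_sq (C - (n + 1) * spread (- {0, 1}))"
        using \<open>C = 0\<close> is_sq_power2[of "1::'a"] by simp
      moreover have "card (- {0, 1::'a}) = m" by (simp add: me card_Compl_finite)
      ultimately show ?thesis by blast
    qed
  qed
  then obtain S z where S: "card S = m" and z: "C - (n + 1) * spread S = z\<^sup>2"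
    by (auto simp: is_sq_def)
  define t where "t = (z - (psum 1 S * (n + 1) + n * a)) / (n * (n + 1))"
  have t: "n * (n + 1) * t = z - (psum 1 S * (n + 1) + n * a)"
    using n by (simp add: t_def)
  have "n * (n + 1) * ((psum 1 S + n * t + a)\<^sup>2 + psum 2 S + 2 * t * psum 1 S + n * t\<^sup>2 - c)
    = (n * (n + 1) * t + (psum 1 S * (n + 1) + n * a))\<^sup>2 - (C - (n + 1) * (n * psum 2 S - (psum 1 S)\<^sup>2))"
    unfolding C_def by (simp add: algebra_simps power2_eq_square)
  also have "\<dots> = 0" unfolding t using z by (simp add: spread_def S n_def)
  finally have "(psum 1 S + n * t + a)\<^sup>2 + psum 2 S + 2 * t * psum 1 S + n * t\<^sup>2 - c = 0"
    using n by (metis mult_eq_0_iff)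
  then have "(psum 1 S + n * t + a)\<^sup>2 + (psum 2 S + 2 * t * psum 1 S + n * t\<^sup>2) = c"
    by (simp add: add.assoc)
  then have "(psum 1 ((\<lambda>x. x + t) ` S) + a)\<^sup>2 + psum 2 ((\<lambda>x. x + t) ` S) = c"
    by (simp only: psum_translate S n_def)
  then show ?thesis using S card_translate by metis
qed

text \<open>With m = 0 in the field, a translation fixes \<open>psum 1 S\<close> and changes
  \<open>psum 2 S\<close> by \<open>2 * t * psum 1 S\<close>, so the equation is linear in
  \<open>t\<close>.\<close>

lemma exists_subset_zero:
  fixes a c :: "'a::{finite,field}"
  assumes two: "(2::'a) \<noteq> 0" and m: "1 \<le> m" "m < CARD('a)" "of_nat m = (0::'a)"
  shows "\<exists>S. card S = m \<and> (psum 1 S + a)\<^sup>2 + psum 2 S = c"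
proof -
  obtain S :: "'a set" where S: "card S = m" "psum 1 S \<noteq> 0"
    using exists_psum_ne_0[OF m(1,2)] by blast
  define t where "t = (c - (psum 1 S + a)\<^sup>2 - psum 2 S) / (2 * psum 1 S)"
  have "2 * t * psum 1 S = c - (psum 1 S + a)\<^sup>2 - psum 2 S"
    using two S by (simp add: t_def)
  then have "(psum 1 ((\<lambda>x. x + t) ` S) + a)\<^sup>2 + psum 2 ((\<lambda>x. x + t) ` S) = c"
    unfolding psum_translate S m by (simp add: algebra_simps)
  then show ?thesis using S card_translate by metis
qed

text \<open>With m = -1 the \<open>t\<^sup>2\<close> terms of the square and of the second power sum
  cancel, leaving slope \<open>- 2 * a\<close> in \<open>t\<close>.\<close>

lemma exists_subset_minus_one:
  fixes a c :: "'a::{finite,field}"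
  assumes two: "(2::'a) \<noteq> 0" and m: "m < CARD('a)" "of_nat m = (- 1::'a)" and a: "a \<noteq> 0"
  shows "\<exists>S. card S = m \<and> (psum 1 S + a)\<^sup>2 + psum 2 S = c"
proof -
  obtain S :: "'a set" where S: "card S = m"
    using obtain_subset_with_card_n[of m "UNIV :: 'a set"] m by auto
  define t where "t = ((psum 1 S + a)\<^sup>2 + psum 2 S - c) / (2 * a)"
  have "2 * a * t = (psum 1 S + a)\<^sup>2 + psum 2 S - c"
    using two a by (simp add: t_def)
  moreover have "(psum 1 S - t + a)\<^sup>2 + (psum 2 S + 2 * t * psum 1 S - t\<^sup>2)
    = (psum 1 S + a)\<^sup>2 + psum 2 S - 2 * a * t"
    by (simp add: algebra_simps power2_eq_square)
  ultimately have "(psum 1 S - t + a)\<^sup>2 + (psum 2 S + 2 * t * psum 1 S - t\<^sup>2) = c"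
    by simp
  then have "(psum 1 ((\<lambda>x. x + t) ` S) + a)\<^sup>2 + psum 2 ((\<lambda>x. x + t) ` S) = c"
    unfolding psum_translate S m by simp
  then show ?thesis using S card_translate by metis
qed

section \<open>Unions of cosets of the prime field\<close>

lemma prime_CHAR_finite: "prime CHAR('a::{finite,field})"
  by (rule prime_CHAR_semidom) (simp add: finite_imp_CHAR_pos)

lemma of_nat_inj_on_CHAR: "inj_on (of_nat :: nat \<Rightarrow> 'a::{finite,field}) {..<CHAR('a)}"
proof (rule linorder_inj_onI)
  fix i j assume ij: "i < j" "i \<in> {..<CHAR('a)}" "j \<in> {..<CHAR('a)}"
  show "of_nat i \<noteq> (of_nat j :: 'a)"
  proof
    assume "of_nat i = (of_nat j :: 'a)"
    then have "of_nat (j - i) = (0::'a)" using ij(1) by (simp add: of_nat_diff)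
    then show False using ij of_nat_eq_0_iff_char_dvd[of "j - i", where 'a = 'a] by (auto dest: dvd_imp_le)
  qed
qed auto

lemma two_sum_of_nat: "2 * (\<Sum>i<n. of_nat i) = (of_nat n * (of_nat n - 1) :: 'a::comm_ring_1)"
  by (induction n) (auto simp: algebra_simps)

lemma six_sum_of_nat_squares:
  "6 * (\<Sum>i<n. (of_nat i)\<^sup>2) = (of_nat n * (of_nat n - 1) * (2 * of_nat n - 1) :: 'a::comm_ring_1)"
  by (induction n) (auto simp: algebra_simps power2_eq_square)

text \<open>For nonzero \<open>d\<close>, the affine line over the prime field through
  \<open>x\<close> with direction \<open>d\<close>; for \<open>d = 1\<close>, an additive coset of
  the prime field.\<close>

definition line :: "'a::{finite,field} \<Rightarrow> 'a \<Rightarrow> 'a set" where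
  "line d x = (\<lambda>i. x + of_nat i * d) ` {..<CHAR('a)}"

text \<open>In odd characteristic this is nonzero only in characteristic 3, where it is 2. Carrying
  it as a constant lets the construction with several cosets cover characteristic 3 too.\<close>

definition prime_field_psum2 :: "'a::{finite,field}" where
  "prime_field_psum2 = (\<Sum>i<CHAR('a). (of_nat i)\<^sup>2)"

text \<open>The closed form for six times the sum has the characteristic as a factor, and 6 is
  invertible here.\<close>

lemma prime_field_psum2_eq_0:
  assumes "CHAR('a) > 3"
  shows "prime_field_psum2 = (0::'a::{finite,field})"
proof -
  have "\<not> CHAR('a) dvd 6"
  proof
    assume d: "CHAR('a) dvd 6"
    then have "CHAR('a) \<le> 6" by (rule dvd_imp_le) simp
    moreover have "odd CHAR('a)"
      using prime_odd_nat[OF prime_CHAR_finite[where 'a = 'a]] assms by simp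
    then have "CHAR('a) \<noteq> 4" "CHAR('a) \<noteq> 6" by auto
    ultimately have "CHAR('a) = 5" using assms by linarith
    then show False using d by simp
  qed
  then have "(6::'a) \<noteq> 0" using of_nat_eq_0_iff_char_dvd[of 6, where 'a = 'a] by simp
  moreover have "6 * prime_field_psum2 = (0::'a)"
    unfolding prime_field_psum2_def six_sum_of_nat_squares by simp
  ultimately show ?thesis by simp
qed

lemma self_in_line: "x \<in> line d x" for x :: "'a::{finite,field}"
  unfolding line_def using finite_imp_CHAR_pos[where 'a = 'a]
  by (intro image_eqI[of _ _ 0]) auto

lemma line_inj_on: "d \<noteq> 0 \<Longrightarrow> inj_on (\<lambda>i. x + of_nat i * d) {..<CHAR('a)}" for x :: "'a::{finite,field}"
  using of_nat_inj_on_CHAR[where 'a = 'a] by (auto simp: inj_on_def)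

lemma card_line: "d \<noteq> 0 \<Longrightarrow> card (line d x) = CHAR('a)" for x :: "'a::{finite,field}"
  unfolding line_def by (simp add: card_image line_inj_on)

lemma psum_line:
  fixes d :: "'a::{finite,field}"
  assumes two: "(2::'a) \<noteq> 0" and d: "d \<noteq> 0"
  shows "psum 1 (line d x) = 0" "psum 2 (line d x) = d\<^sup>2 * prime_field_psum2"
proof -
  have "2 * (\<Sum>i<CHAR('a). of_nat i) = (0::'a)" unfolding two_sum_of_nat by simp
  then have s: "(\<Sum>i<CHAR('a). of_nat i) = (0::'a)" using two by simp
  have re: "psum k (line d x) = (\<Sum>i<CHAR('a). (x + of_nat i * d) ^ k)" for k
    unfolding psum_def line_def by (subst sum.reindex[OF line_inj_on[OF d]]) simp
  have "psum 1 (line d x) = of_nat CHAR('a) * x + (\<Sum>i<CHAR('a). of_nat i) * d"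
    unfolding re by (simp add: sum.distrib sum_distrib_right)
  then show "psum 1 (line d x) = 0" by (simp add: s)
  have "psum 2 (line d x) = of_nat CHAR('a) * x\<^sup>2 + (\<Sum>i<CHAR('a). (of_nat i)\<^sup>2) * d\<^sup>2
      + 2 * x * d * (\<Sum>i<CHAR('a). of_nat i)"
    unfolding re power2_sum
    by (simp add: sum.distrib sum_distrib_right sum_distrib_left power_mult_distrib mult_ac)
  then show "psum 2 (line d x) = d\<^sup>2 * prime_field_psum2"
    by (simp add: s prime_field_psum2_def)
qed

text \<open>The index counts the cosets. Asking only for \<open>x \<notin> T\<close> is enough for
  disjointness: \<open>T\<close> is closed under adding prime field elements, so a coset meeting
  \<open>T\<close> would contain \<open>x\<close> in \<open>T\<close>.\<close>

inductive line_union :: "nat \<Rightarrow> 'a::{finite,field} set \<Rightarrow> bool" where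
  line_union_0: "line_union 0 {}"
| line_union_Suc: "line_union j T \<Longrightarrow> x \<notin> T \<Longrightarrow> line_union (Suc j) (T \<union> line 1 x)"

lemma line_union_closed: "line_union j T \<Longrightarrow> x \<in> T \<Longrightarrow> x + of_nat n \<in> T"
proof (induction arbitrary: x rule: line_union.induct)
  case (line_union_Suc j T y)
  have "x + of_nat n \<in> line 1 y" if x: "x \<in> line 1 y"
  proof -
    obtain i where i: "x = y + of_nat i" using x by (auto simp: line_def)
    have "(i + n) mod CHAR('a) < CHAR('a)"
      using finite_imp_CHAR_pos[where 'a = 'a] by simp
    moreover have "of_nat ((i + n) mod CHAR('a)) = (of_nat (i + n) :: 'a)"
    proof -
      have "of_nat (i + n) = (of_nat (CHAR('a) * ((i + n) div CHAR('a)) + (i + n) mod CHAR('a)) :: 'a)"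
        by simp
      then show ?thesis unfolding of_nat_add of_nat_mult by simp
    qed
    ultimately show ?thesis unfolding line_def i
      by (intro image_eqI[of _ _ "(i + n) mod CHAR('a)"]) (auto simp: add.assoc)
  qed
  then show ?case using line_union_Suc by blast
qed simp

lemma line_union_disjoint_line:
  assumes "line_union j T" "x \<notin> T"
  shows "T \<inter> line 1 x = {}"
proof (rule ccontr)
  assume "T \<inter> line 1 x \<noteq> {}"
  then obtain i where i: "i < CHAR('a)" "x + of_nat i \<in> T" by (auto simp: line_def)
  have "x + of_nat i + of_nat (CHAR('a) - i) \<in> T" by (rule line_union_closed[OF assms(1) i(2)])
  moreover have "x + of_nat i + of_nat (CHAR('a) - i) = x" using i(1) by (simp add: of_nat_diff)
  ultimately show False using assms(2) by simp
qed

lemma line_union_psum: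
  assumes two: "(2::'a::{finite,field}) \<noteq> 0" and "line_union j (T::'a set)"
  shows "card T = CHAR('a) * j \<and> psum 1 T = 0 \<and> psum 2 T = of_nat j * prime_field_psum2"
  using assms(2)
proof (induction rule: line_union.induct)
  case line_union_0
  then show ?case by (simp add: psum_def)
next
  case (line_union_Suc j T x)
  have dj: "T \<inter> line 1 x = {}" using line_union_disjoint_line line_union_Suc by blast
  show ?case
    using line_union_Suc.IH card_line[of 1 x] psum_line[OF two, of 1 x] dj
    by (simp add: card_Un_disjoint psum_union algebra_simps)
qed

text \<open>A union of fewer than \<open>j\<close> cosets does not exhaust the field, and any point
  outside it starts another coset.\<close>

lemma line_union_extend:
  assumes two: "(2::'a::{finite,field}) \<noteq> 0"
    and "i \<le> j" "line_union i (T::'a set)" "CHAR('a) * j \<le> CARD('a)"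
  shows "\<exists>T'. T \<subseteq> T' \<and> line_union j T'"
  using assms(2,4)
proof (induction j rule: dec_induct)
  case base
  then show ?case using assms(3) by blast
next
  case (step k)
  then obtain T' where T': "T \<subseteq> T'" "line_union k T'" by auto
  have "card T' < CARD('a)"
    using line_union_psum[OF two T'(2)] step.prems finite_imp_CHAR_pos[where 'a = 'a] by simp
  then obtain x where "x \<notin> T'" by (metis UNIV_eq_I nat_neq_iff)
  then show ?case using T' line_union.line_union_Suc by blast
qed

text \<open>Take a union \<open>U\<close> of \<open>j + 1\<close> cosets containing the prime field
  \<open>K\<close> and two further points \<open>r\<close>, \<open>s\<close>; remove
  \<open>K\<close>, \<open>r\<close>, \<open>s\<close> and put back 0. The expression becomes
  \<open>(r + s)\<^sup>2 - r\<^sup>2 - s\<^sup>2 + ?P\<close>, that is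
  \<open>2 * r * s + ?P\<close>, so \<open>r * s = e\<close> is what is needed.\<close>

lemma exists_subset_prime_power_aux:
  fixes c :: "'a::{finite,field}"
  assumes two: "(2::'a) \<noteq> 0" and j: "2 \<le> j" "CHAR('a) * (j + 1) \<le> CARD('a)"
    and c: "c \<noteq> of_nat j * prime_field_psum2"
  shows "\<exists>S. card S = CHAR('a) * j - 1 \<and> (psum 1 S)\<^sup>2 + psum 2 S = c"
proof -
  let ?P = "of_nat j * prime_field_psum2 :: 'a"
  have p: "CHAR('a) > 2"
  proof -
    have "CHAR('a) \<noteq> 2" using two of_nat_CHAR[where 'a = 'a] by (metis of_nat_numeral)
    then show ?thesis using prime_ge_2_nat[OF prime_CHAR_finite[where 'a = 'a]] by linarith
  qed
  define e where "e = (c - ?P) / 2"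
  have e: "e \<noteq> 0" "2 * e = c - ?P" using c two by (simp_all add: e_def)
  define K where "K = line 1 (0::'a)"
  have cK: "card K = CHAR('a)" by (simp add: K_def card_line)
  \<comment> \<open>Values of \<open>r\<close> to avoid: those in \<open>K\<close>, those with
    \<open>e / r\<close> in \<open>K\<close>, and those with \<open>r = s\<close>. The default value
    \<open>e / 0 = 0\<close> lies in \<open>K\<close> anyway. This excludes at most 2p + 2 < 3p
    values, p being the characteristic.\<close>
  define B where "B = K \<union> (\<lambda>k. e / k) ` K \<union> {r. 1 * r\<^sup>2 + 0 * r + (- e) = 0}"
  have "card B \<le> card K + card ((\<lambda>k. e / k) ` K) + card {r. 1 * r\<^sup>2 + 0 * r + (- e) = 0}"
    unfolding B_def by (meson add_le_mono card_Un_le le_refl le_trans)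
  also have "\<dots> \<le> CHAR('a) + CHAR('a) + 2"
    using cK card_image_le[of K "\<lambda>k. e / k"] card_quadratic_roots_le[of 1 0 "- e"]
    by (intro add_le_mono) auto
  also have "\<dots> < CHAR('a) * 3" using p by simp
  also have "\<dots> \<le> CHAR('a) * (j + 1)" using j(1) by (intro mult_le_mono) auto
  finally have "card B < CARD('a)" using j(2) by simp
  then obtain r where "r \<notin> B" by (metis UNIV_eq_I nat_neq_iff)
  then have r: "r \<notin> K" "\<forall>k\<in>K. r \<noteq> e / k" "r\<^sup>2 \<noteq> e" by (auto simp: B_def)
  have r0: "r \<noteq> 0" using r(1) self_in_line[of "0::'a" 1] by (auto simp: K_def)
  define s where "s = e / r"
  have rs: "r * s = e" using r0 by (simp add: s_def)
  have s: "s \<notin> K" using r(2) rs e(1) by (metis mult_eq_0_iff nonzero_mult_div_cancel_right)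
  have ne: "r \<noteq> s" using rs r(3) by (auto simp: power2_eq_square)
  have K: "line_union (Suc 0) K" using line_union_Suc[OF line_union_0, of 0] by (simp add: K_def)
  \<comment> \<open>\<open>s\<close> may lie in \<open>K\<close> enlarged by the coset of
    \<open>r\<close>, so two or three cosets are used; \<open>j + 1\<close> is at least 3.\<close>
  obtain i T where T: "i \<le> 3" "line_union i T" "K \<subseteq> T" "r \<in> T" "s \<in> T"
  proof (cases "s \<in> K \<union> line 1 r")
    case True
    have "line_union 2 (K \<union> line 1 r)"
      using line_union_Suc[OF K r(1)] by (simp add: numeral_2_eq_2)
    then show ?thesis by (rule that[rotated]) (use True self_in_line in auto)
  next
    case False
    have "line_union 3 (K \<union> line 1 r \<union> line 1 s)"
      using line_union_Suc[OF line_union_Suc[OF K r(1)] False] by (simp add: numeral_3_eq_3)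
    then show ?thesis by (rule that[rotated]) (use self_in_line in auto)
  qed
  obtain U where U: "T \<subseteq> U" "line_union (j + 1) U"
    using line_union_extend[OF two _ T(2), of "j + 1"] T(1) j by auto
  have KU: "K \<subseteq> U" "r \<in> U - K" "s \<in> U - K - {r}" using T U r s ne by auto
  define S where "S = U - K - {r} - {s}"
  have split: "psum k U = psum k K + psum k (U - K)" for k
    using psum_union[of K "U - K" k] KU(1) by (simp add: Un_absorb1)
  have ps: "psum k S = psum k U - psum k K - r ^ k - s ^ k" for k
    unfolding S_def using KU split by (simp add: psum_remove)
  have zero: "0 \<notin> S" using self_in_line[of "0::'a" 1] by (auto simp: S_def K_def)
  note psums = line_union_psum[OF two U(2)] line_union_psum[OF two K]
  have "psum 1 (insert 0 S) = - r - s" using zero psums by (simp add: psum_insert ps)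
  moreover have "psum 2 (insert 0 S) = ?P - r\<^sup>2 - s\<^sup>2"
    using zero psums by (simp add: psum_insert ps algebra_simps)
  ultimately have "(psum 1 (insert 0 S))\<^sup>2 + psum 2 (insert 0 S)
    = (- r - s)\<^sup>2 + (?P - r\<^sup>2 - s\<^sup>2)" by simp
  also have "\<dots> = 2 * (r * s) + ?P" by (simp add: algebra_simps power2_eq_square)
  also have "\<dots> = c" by (simp add: rs e)
  finally have "(psum 1 (insert 0 S))\<^sup>2 + psum 2 (insert 0 S) = c" .
  moreover have "card (insert 0 S) = CHAR('a) * j - 1"
  proof -
    have "card (U - K) = CHAR('a) * j"
      using KU(1) psums by (simp add: card_Diff_subset algebra_simps)
    moreover have "card S = card (U - K) - 2" using KU by (simp add: S_def)
    moreover have "CHAR('a) * j \<ge> 2" using p j(1) by (metis le_trans mult_le_mono nat_mult_1 one_le_numeral less_imp_le_nat)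
    ultimately show ?thesis using zero by simp
  qed
  ultimately show ?thesis by blast
qed

text \<open>A line through \<open>y\<close> with direction \<open>k * y\<close> has both power sums
  zero in characteristic above 3. If it avoids 0, replacing its points \<open>y\<close> and
  \<open>y + k * y\<close> by 0 yields the value \<open>2 * y\<^sup>2 * (1 + k)\<close>, which
  determines \<open>k\<close> from \<open>y\<close> and \<open>c\<close>.\<close>

lemma exists_subset_prime_aux:
  fixes c :: "'a::{finite,field}"
  assumes two: "(2::'a) \<noteq> 0" and p: "CHAR('a) > 3" "CHAR('a) * 3 \<le> CARD('a)" and c: "c \<noteq> 0"
  shows "\<exists>S. card S = CHAR('a) - 1 \<and> (psum 1 S)\<^sup>2 + psum 2 S = c"
proof -
  \<comment> \<open>For nonzero \<open>y\<close>, membership in \<open>R i\<close> means that the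
    point \<open>y + of_nat i * (k * y)\<close> is 0, multiplied by \<open>2 * y\<close> and with
    \<open>k\<close> eliminated; \<open>R 0\<close> is {0}. The other excluded set,
    \<open>2 * y\<^sup>2 = c\<close>, would make \<open>k\<close> zero.\<close>
  define R where "R i = {y::'a. (2 * (1 - of_nat i)) * y\<^sup>2 + 0 * y + c * of_nat i = 0}" for i
  have R: "card (R i) \<le> 2" for i
    unfolding R_def using card_quadratic_roots_le[of "2 * (1 - of_nat i)" 0 "c * of_nat i"] two c
    by (cases "of_nat i = (0::'a)") auto
  have "card ((\<Union>i<CHAR('a). R i) \<union> {y. 2 * y\<^sup>2 + 0 * y + (- c) = 0})
    \<le> card (\<Union>i<CHAR('a). R i) + card {y. 2 * y\<^sup>2 + 0 * y + (- c) = 0}" by (rule card_Un_le)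
  also have "\<dots> \<le> (\<Sum>i<CHAR('a). card (R i)) + 2"
    using card_quadratic_roots_le[of 2 0 "- c"] c by (intro add_le_mono card_UN_le) auto
  also have "\<dots> \<le> CHAR('a) * 2 + 2"
    using sum_bounded_above[of "{..<CHAR('a)}" "\<lambda>i. card (R i)" 2] R by simp
  also have "\<dots> < CARD('a)" using p by linarith
  finally obtain y where "y \<notin> (\<Union>i<CHAR('a). R i) \<union> {y. 2 * y\<^sup>2 + 0 * y + (- c) = 0}"
    by (metis UNIV_eq_I nat_neq_iff)
  then have y: "\<And>i. i < CHAR('a) \<Longrightarrow> y \<notin> R i" "2 * y\<^sup>2 \<noteq> c" by auto
  have y0: "y \<noteq> 0" using y(1)[of 0] p by (auto simp: R_def)
  define k where "k = c / (2 * y\<^sup>2) - 1"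
  have k: "2 * y\<^sup>2 * (1 + k) = c" using y0 two by (simp add: k_def)
  have k0: "k \<noteq> 0" using k y(2) by auto
  define L where "L = line (k * y) y"
  have d: "k * y \<noteq> 0" using k0 y0 by simp
  have zero: "0 \<notin> L"
  proof
    assume "0 \<in> L"
    then obtain i where i: "i < CHAR('a)" "y + of_nat i * (k * y) = 0"
      by (force simp: L_def line_def)
    have "(2 * (1 - of_nat i)) * y\<^sup>2 + 0 * y + c * of_nat i = 2 * y * (y + of_nat i * (k * y))"
      unfolding k[symmetric] by (simp add: algebra_simps power2_eq_square)
    also have "\<dots> = 0" using i by simp
    finally show False using y(1)[OF i(1)] by (simp add: R_def)
  qed
  have yL: "y \<in> L" by (simp add: L_def self_in_line)
  have sL: "y + k * y \<in> L - {y}"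
    using d p(1) unfolding L_def line_def by (auto intro!: image_eqI[of _ _ 1])
  define S where "S = L - {y} - {y + k * y}"
  have ps: "psum i S = psum i L - y ^ i - (y + k * y) ^ i" for i
    unfolding S_def using yL sL by (simp add: psum_remove)
  have z: "0 \<notin> S" using zero by (auto simp: S_def)
  have L: "psum 1 L = 0" "psum 2 L = 0"
    using psum_line[OF two d, of y] prime_field_psum2_eq_0[OF p(1)] by (simp_all add: L_def)
  have "(psum 1 (insert 0 S))\<^sup>2 + psum 2 (insert 0 S) = 2 * y\<^sup>2 * (1 + k)"
    using z L by (simp add: psum_insert ps algebra_simps power2_eq_square)
  moreover have "card (insert 0 S) = CHAR('a) - 1"
    using z yL sL card_line[OF d, of y] p(1) by (simp add: S_def L_def)
  ultimately show ?thesis using k by metis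
qed

text \<open>Here m + 1 is \<open>j\<close> times the characteristic. A union of \<open>j\<close>
  cosets minus any one point settles \<open>c = of_nat j * prime_field_psum2\<close>; other
  \<open>c\<close> use the two preceding constructions, for \<open>j \<ge> 2\<close> and
  \<open>j = 1\<close>.\<close>

lemma exists_subset_minus_one_homogeneous:
  fixes c :: "'a::{finite,field}"
  assumes two: "(2::'a) \<noteq> 0" and q: "CARD('a) > 3"
    and m: "3 \<le> m" "m \<le> CARD('a) - 2" "of_nat m = (- 1::'a)"
  shows "\<exists>S. card S = m \<and> (psum 1 S)\<^sup>2 + psum 2 S = c"
proof -
  have "of_nat (m + 1) = (0::'a)" using m(3) by simp
  then obtain j where j: "m + 1 = CHAR('a) * j" using of_nat_eq_0_iff_char_dvd by blast
  obtain l where l: "CARD('a) = CHAR('a) * l"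
    using psum_UNIV(3)[OF two q] of_nat_eq_0_iff_char_dvd by blast
  have "CHAR('a) * j < CHAR('a) * l" using j l m q by linarith
  then have jl: "j + 1 \<le> l" by simp
  then have le: "CHAR('a) * (j + 1) \<le> CARD('a)" unfolding l by (rule mult_le_mono2)
  have j0: "j \<noteq> 0" using j by (intro notI) simp
  show ?thesis
  proof (cases "c = of_nat j * prime_field_psum2")
    case True
    have le': "CHAR('a) * j \<le> CARD('a)" using le by simp
    obtain T :: "'a set" where T: "line_union j T"
      using line_union_extend[OF two le0 line_union_0 le'] by blast
    note psums = line_union_psum[OF two T]
    have "card T \<noteq> 0" using psums j by (metis Suc_eq_plus1 nat.distinct(1))
    then obtain r where r: "r \<in> T" by fastforce
    have "(psum 1 (T - {r}))\<^sup>2 + psum 2 (T - {r}) = c"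
      using r psums True by (simp add: psum_remove)
    moreover have "card (T - {r}) = m" using r psums j by simp
    ultimately show ?thesis by blast
  next
    case c: False
    show ?thesis
    proof (cases "j \<ge> 2")
      case True
      then show ?thesis using exists_subset_prime_power_aux[OF two True le c] j
        by (metis add_diff_cancel_right')
    next
      case False
      then have j1: "j = 1" using j0 by simp
      have p: "CHAR('a) > 3" using j j1 m by simp
      \<comment> \<open>An odd q forces at least three cosets, as \<open>prime_aux\<close>
        requires.\<close>
      have "l \<noteq> 2" using odd_CARD_field[OF two] l by auto
      then have "3 \<le> l" using jl j1 by simp
      then have "CHAR('a) * 3 \<le> CARD('a)" unfolding l by (rule mult_le_mono2)
      moreover have "c \<noteq> 0" using c prime_field_psum2_eq_0[OF p] by simp
      ultimately show ?thesis
        using exists_subset_prime_aux[OF two p] j j1 by (metis add_diff_cancel_right' mult.right_neutral)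
    qed
  qed
qed

lemma exists_subset:
  fixes a c :: "'a::{finite,field}"
  assumes two: "(2::'a) \<noteq> 0" and q: "CARD('a) > 3" and m: "3 \<le> m" "m \<le> CARD('a) - 2"
  shows "\<exists>S. card S = m \<and> (psum 1 S + a)\<^sup>2 + psum 2 S = c"
proof -
  have "m < CARD('a)" "1 \<le> m" using m q by linarith+
  then show ?thesis
    using exists_subset_zero[OF two, of m a c] exists_subset_minus_one[OF two, of m a c]
      exists_subset_minus_one_homogeneous[OF two q m, of c] exists_subset_generic[OF two q m, of a c]
    by (cases "a = 0") auto
qed

section \<open>Codewords agreeing with a polynomial of degree k + 2\<close>

definition vanishing_poly :: "'a::comm_ring_1 set \<Rightarrow> 'a poly" where
  "vanishing_poly S = (\<Prod>x\<in>S. [:- x, 1:])"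

lemma poly_vanishing_poly: "finite S \<Longrightarrow> x \<in> S \<Longrightarrow> poly (vanishing_poly S) x = 0"
  by (auto simp: vanishing_poly_def poly_prod intro!: prod_zero)

text \<open>The factor \<open>x\<^sup>2\<close> avoids negative indices when \<open>S\<close> has fewer than two elements.\<close>
lemma coeff_vanishing_poly:
  fixes S :: "'a::idom set"
  assumes "finite S"
  defines "Q \<equiv> [:0, 0, 1:] * vanishing_poly S"
  shows "degree Q \<le> card S + 2 \<and> coeff Q (card S + 2) = 1 \<and> coeff Q (card S + 1) = - psum 1 S
    \<and> 2 * coeff Q (card S) = (psum 1 S)\<^sup>2 - psum 2 S"
  unfolding Q_def using assms(1)
proof (induction S rule: finite_induct)
  case empty
  then show ?case by (simp add: vanishing_poly_def psum_def)
next
  case (insert t S)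
  let ?Q = "[:0, 0, 1:] * vanishing_poly S"
  have eq: "[:0, 0, 1:] * vanishing_poly (insert t S) = [:- t, 1:] * ?Q"
    using insert.hyps by (simp add: vanishing_poly_def mult_ac)
  have co: "coeff ([:- t, 1:] * P) (Suc i) = coeff P i - t * coeff P (Suc i)" for i P
    by (simp add: coeff_pCons)
  have dg: "degree ([:- t, 1:] * ?Q) \<le> card S + 3"
    using degree_mult_le[of "[:- t, 1:]" ?Q] insert.IH by simp
  have z: "coeff ?Q (card S + 3) = 0" using insert.IH by (intro coeff_eq_0) simp
  have c: "card (insert t S) = Suc (card S)" using insert.hyps by simp
  have i1: "coeff ([:- t, 1:] * ?Q) (Suc (card S) + 2) = 1"
    using co[of ?Q "card S + 2"] z insert.IH by (simp add: numeral_3_eq_3)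
  have i2: "coeff ([:- t, 1:] * ?Q) (Suc (card S) + 1) = - psum 1 S - t"
    using co[of ?Q "card S + 1"] insert.IH by simp
  have "2 * coeff ([:- t, 1:] * ?Q) (Suc (card S)) = 2 * coeff ?Q (card S) - 2 * t * coeff ?Q (card S + 1)"
    unfolding co by (simp add: algebra_simps)
  also have "\<dots> = (psum 1 S)\<^sup>2 - psum 2 S + 2 * t * psum 1 S" using insert.IH by simp
  finally have i3: "2 * coeff ([:- t, 1:] * ?Q) (Suc (card S)) = (psum 1 S)\<^sup>2 - psum 2 S + 2 * t * psum 1 S" .
  show ?case
    unfolding eq c i1 i2 i3 using dg insert.hyps
    by (auto simp: psum_insert algebra_simps power2_eq_square)
qed

lemma coeff_x2_mult: "coeff ([:0, 0, 1:] * P) (n + 2) = coeff P (n :: nat)" for P :: "'a::comm_ring_1 poly"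
  by (simp add: numeral_2_eq_2 coeff_pCons)

text \<open>These are signed elementary symmetric functions, the second one expressed through power
  sums by Newton's identity.\<close>

lemma vanishing_poly_coeffs:
  fixes S :: "'a::idom set"
  assumes "finite S" "card S = Suc k" "k \<ge> 1"
  shows "degree (vanishing_poly S) \<le> Suc k" "coeff (vanishing_poly S) (Suc k) = 1"
    "coeff (vanishing_poly S) k = - psum 1 S"
    "2 * coeff (vanishing_poly S) (k - 1) = (psum 1 S)\<^sup>2 - psum 2 S"
proof -
  let ?Q = "[:0, 0, 1:] * vanishing_poly S"
  note Q = coeff_vanishing_poly[OF assms(1)]
  show "degree (vanishing_poly S) \<le> Suc k"
  proof (rule degree_le, safe)
    fix i assume "Suc k < i"
    then have "coeff ?Q (i + 2) = 0" using Q assms by (intro coeff_eq_0) simp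
    then show "coeff (vanishing_poly S) i = 0" by (simp only: coeff_x2_mult)
  qed
  show "coeff (vanishing_poly S) (Suc k) = 1"
    using Q assms(2) coeff_x2_mult[of "vanishing_poly S" "Suc k"] by simp
  show "coeff (vanishing_poly S) k = - psum 1 S"
    using Q assms(2) coeff_x2_mult[of "vanishing_poly S" k] by simp
  show "2 * coeff (vanishing_poly S) (k - 1) = (psum 1 S)\<^sup>2 - psum 2 S"
    using Q assms(2,3) coeff_x2_mult[of "vanishing_poly S" "k - 1"] by simp
qed

text \<open>The remainder of \<open>?f\<close> modulo the vanishing polynomial of \<open>S\<close>
  agrees with \<open>?f\<close> on \<open>S\<close> and has degree at most \<open>k\<close>; the
  hypothesis \<open>eq\<close> says that its coefficient of x^k vanishes.\<close>

lemma exists_interpolant: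
  fixes S :: "'a::field set"
  assumes two: "(2::'a) \<noteq> 0" and u: "u \<noteq> 0" and S: "finite S" "card S = Suc k" and k: "k \<ge> 1"
    and h: "degree h < k"
    and eq: "(psum 1 S + a / u)\<^sup>2 + psum 2 S = (a / u)\<^sup>2 - 2 * b / u"
  shows "\<exists>g. degree g < k \<and>
    (\<forall>x\<in>S. poly g x = poly (monom u (k + 2) + monom a (k + 1) + monom b k + h) x)"
proof -
  let ?f = "monom u (k + 2) + monom a (k + 1) + monom b k + h" and ?P = "vanishing_poly S"
  note P = vanishing_poly_coeffs[OF S k]
  \<comment> \<open>\<open>[:v, u:]\<close> is the quotient: the coefficient of x^k in
    \<open>?P\<close> is \<open>- psum 1 S\<close>, so this \<open>v\<close> produces
    \<open>a\<close> at x^(k+1).\<close>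
  define v where "v = a + u * psum 1 S"
  define g where "g = ?f - [:v, u:] * ?P"
  have co: "coeff ([:v, u:] * ?P) (Suc i) = v * coeff ?P (Suc i) + u * coeff ?P i" for i
    by (simp add: coeff_pCons)
  have k1: "Suc (k - 1) = k" using k by simp
  \<comment> \<open>Twice the comparison of the x^k coefficients, obtained from \<open>eq\<close>
    multiplied by \<open>u\<close>.\<close>
  have "u * (2 * coeff ?P (k - 1)) + 2 * v * coeff ?P k = 2 * b"
  proof -
    have "u * ((psum 1 S + a / u)\<^sup>2 + psum 2 S) = u * ((a / u)\<^sup>2 - 2 * b / u)" using eq by simp
    moreover have "u * ((psum 1 S + a / u)\<^sup>2 + psum 2 S)
      = u * (psum 1 S)\<^sup>2 + 2 * a * psum 1 S + u * psum 2 S + u * (a / u)\<^sup>2"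
      using u by (simp add: field_simps power2_eq_square)
    moreover have "u * ((a / u)\<^sup>2 - 2 * b / u) = u * (a / u)\<^sup>2 - 2 * b"
      using u by (simp add: right_diff_distrib)
    ultimately have "u * (psum 1 S)\<^sup>2 + 2 * a * psum 1 S + u * psum 2 S + u * (a / u)\<^sup>2
      = - 2 * b + u * (a / u)\<^sup>2" by simp
    then have "u * (psum 1 S)\<^sup>2 + 2 * a * psum 1 S + u * psum 2 S = - 2 * b"
      by (rule add_right_imp_eq)
    moreover have "u * ((psum 1 S)\<^sup>2 - psum 2 S) + 2 * v * (- psum 1 S)
      = - (u * (psum 1 S)\<^sup>2 + 2 * a * psum 1 S + u * psum 2 S)"
      unfolding v_def by (simp add: algebra_simps power2_eq_square)
    ultimately show ?thesis unfolding P(3,4) by simp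
  qed
  then have "2 * (v * coeff ?P k + u * coeff ?P (k - 1)) = 2 * b" by (simp add: algebra_simps)
  then have "v * coeff ?P k + u * coeff ?P (k - 1) = b" using two by (metis mult_left_cancel)
  then have c0: "coeff ([:v, u:] * ?P) k = b" using co[of "k - 1"] unfolding k1 by simp
  have c1: "coeff ([:v, u:] * ?P) (k + 1) = a" using co[of k] P by (simp add: v_def)
  have Pz: "coeff ?P i = 0" if "i > Suc k" for i using that P(1) by (intro coeff_eq_0) simp
  have c2: "coeff ([:v, u:] * ?P) (k + 2) = u" using co[of "k + 1"] P Pz by simp
  have c3: "coeff ([:v, u:] * ?P) i = 0" if "i > k + 2" for i
    using co[of "i - 1"] Pz that by simp
  have hz: "coeff h i = 0" if "i \<ge> k" for i using that h by (intro coeff_eq_0) simp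
  have gz: "coeff g i = 0" if "i \<ge> k" for i
  proof -
    consider "i = k" | "i = k + 1" | "i = k + 2" | "i > k + 2" using \<open>i \<ge> k\<close> by linarith
    then show ?thesis
      by cases (use c0 c1 c2 c3 hz in \<open>simp_all add: g_def del: mult_pCons_left\<close>)
  qed
  have "degree g \<le> k - 1" by (rule degree_le) (use gz in auto)
  then have "degree g < k" using k by linarith
  moreover have "poly g x = poly ?f x" if "x \<in> S" for x
    using poly_vanishing_poly[OF S(1) that] by (simp add: g_def)
  ultimately show ?thesis by blast
qed

section \<open>From agreement on a set to a bound on the error distance\<close>

lemma hamming_dist_eval_word_le:
  assumes xs: "distinct xs" and S: "S \<subseteq> set xs" "\<forall>x\<in>S. poly f x = poly g x"
  shows "hamming_dist (eval_word xs f) (eval_word xs g) \<le> length xs - card S"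
proof -
  let ?I = "{i. i < length (eval_word xs f) \<and> eval_word xs f ! i \<noteq> eval_word xs g ! i}"
  have "card ?I = card ((!) xs ` ?I)"
    using xs by (intro card_image[symmetric]) (auto simp: inj_on_def eval_word_def nth_eq_iff_index_eq)
  also have "\<dots> \<le> card (set xs - S)"
    using S(2) by (intro card_mono) (auto simp: eval_word_def)
  also have "\<dots> = length xs - card S"
    using S(1) xs by (simp add: card_Diff_subset finite_subset distinct_card)
  finally show ?thesis by (simp add: hamming_dist_def)
qed

lemma error_dist_le:
  assumes "w \<in> C"
  shows "error_dist v C \<le> hamming_dist v w"
proof -
  have "hamming_dist v w \<le> length v" for w
    using card_mono[of "{..<length v}" "{i. i < length v \<and> v ! i \<noteq> w ! i}"]
    by (auto simp: hamming_dist_def)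
  then have "finite {hamming_dist v w | w. w \<in> C}"
    by (auto intro: finite_subset[of _ "{..length v}"])
  then show ?thesis unfolding error_dist_def using assms by (intro Min_le) auto
qed

theorem theorem4p3:
  fixes xs :: "'a::{finite,field} list"
    and k :: nat
    and u a b :: 'a
    and h :: "'a poly"
  assumes "odd CHAR('a)"
    and "CARD('a) > 5"
    and "distinct xs" and "set xs = UNIV"
    and "2 \<le> k" and "k \<le> CARD('a) - 3"
    and "u \<noteq> 0"
    and "degree h \<le> k - 1"
  shows "\<not> defines_deep_hole k xs (monom u (k + 2) + monom a (k + 1) + monom b k + h)"
proof -
  let ?f = "monom u (k + 2) + monom a (k + 1) + monom b k + h"
  have two: "(2::'a) \<noteq> 0"
  proof
    assume "(2::'a) = 0"
    then have "CHAR('a) dvd 2" using of_nat_eq_0_iff_char_dvd[of 2, where 'a = 'a] by simp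
    then have "CHAR('a) = 1 \<or> CHAR('a) = 2" using two_is_prime_nat by (metis prime_nat_iff)
    then show False using assms(1) by auto
  qed
  \<comment> \<open>The set sought has \<open>k + 1\<close> points, so the range of \<open>k\<close>
    becomes the one in \<open>exists_subset\<close>.\<close>
  have "CARD('a) > 3" "3 \<le> Suc k" "Suc k \<le> CARD('a) - 2" using assms by linarith+
  then obtain S :: "'a set" where S: "card S = Suc k"
      "(psum 1 S + a / u)\<^sup>2 + psum 2 S = (a / u)\<^sup>2 - 2 * b / u"
    using exists_subset[OF two] by blast
  have "finite S" "k \<ge> 1" "degree h < k" using assms by auto
  then obtain g where g: "degree g < k" "\<forall>x\<in>S. poly g x = poly ?f x"
    using exists_interpolant[OF two assms(7) _ S(1) _ _ S(2)] by blast
  have len: "length xs = CARD('a)" using assms(3,4) by (metis distinct_card)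
  have "eval_word xs g \<in> GRS k xs" using g(1) by (auto simp: GRS_def)
  then have "error_dist (eval_word xs ?f) (GRS k xs) \<le> hamming_dist (eval_word xs ?f) (eval_word xs g)"
    by (rule error_dist_le)
  also have "\<dots> \<le> length xs - Suc k"
    using hamming_dist_eval_word_le[OF assms(3), of S ?f g] g(2) assms(4) S(1) by simp
  \<comment> \<open>Strict because \<open>k < length xs\<close>, so \<open>length xs - k\<close> is
    not truncated to 0.\<close>
  also have "\<dots> < length xs - k" using len assms by linarith
  finally show ?thesis by (simp add: defines_deep_hole_def)
qed

end
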